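(* Let $\beta=(\beta_n)_{n\in\mathbb{N}}$ be a stable exponent sequence, $K(a_{n,k})$ a Köthe space, and $\theta=(\theta_t)_{t\ge0}$ a scalar sequence. Then $\hat T_\theta:K(a_{n,k})\to\Lambda_\infty(\beta)$ is well-defined and continuous if and only if $\theta\in\Lambda_\infty(\beta)$ and $$\forall k\in\mathbb{N}\ \exists m\in\mathbb{N},\,C>0\ \ \forall n\in\mathbb{N}:\quad e^{k\beta_n}\le C a_{n,m}.$$
   Context: $\mathbb{N}=\{1,2,3,\dots\}$. A Köthe matrix is a matrix $(a_{n,k})_{n,k\in\mathbb{N}}$ of non-negative numbers such that for each $n$ there is $k$ with $a_{n,k}>0$, and $a_{n,k}\le a_{n,k+1}$ for all $n,k$. The Köthe space is $K(a_{n,k})=\{x=(x_n)_{n\in\mathbb{N}}:\|x\|_k:=\sum_n|x_n|a_{n,k}<\infty\ \forall k\in\mathbb{N}\}$, a Fréchet space with the seminorms $\|\cdot\|_k$. An exponent sequence is a non-negative increasing sequence $\beta=(\beta_n)_{n\in\mathbb{N}}$ with $\beta_n\to\infty$; it is stable if $\sup_n\beta_{2n}/\beta_n<\infty$ (i.e. there is $M$ with $\beta_{2n}\le M\beta_n$ for all $n$). The power series space of infinite type $\Lambda_\infty(\beta)$ is the Köthe space with matrix $(e^{k\beta_n})_{n,k}$. $e_n$ is the sequence with $1$ in the $n$-th place and $0$ elsewhere. For a sequence $\theta=(\theta_0,\theta_1,\theta_2,\dots)$ (regarded as an element of a sequence space indexed by $\mathbb{N}$ by letting its $n$-th coordinate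 be $\theta_{n-1}$), the operator $\hat T_\theta$ given by the lower triangular Toeplitz matrix of $\theta$ is $\hat T_\theta e_n=\sum_{j=n}^\infty\theta_{j-n}e_j$, $\hat T_\theta x=\sum_n x_n\hat T_\theta e_n$ for $x=\sum_n x_ne_n$; it is well-defined if each $\hat T_\theta e_n$ lies in the target space and the series converges there for every $x$ in the domain. Standing assumption: $\theta_t\ne 0$ for infinitely many $t$. *)

theory Defs
  imports "HOL-Analysis.Analysis"
begin

(* Sequences (x_1, x_2, ...) and matrices with indices in {1, 2, ...} are functions on nat of
   which only the values at arguments >= 1 are used.  Elements of sequence spaces are
   normalised to have value 0 at the unused index 0, so that distinct functions in a space are
   distinct sequences.  The scalars are an arbitrary type of class {real_normed_field, banach};
   this covers both real and complex. *)

definition koethe_matrix :: "(nat \<Rightarrow> nat \<Rightarrow> real) \<Rightarrow> bool" where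
  "koethe_matrix a \<longleftrightarrow>
     (\<forall>n\<ge>1. \<forall>k\<ge>1. 0 \<le> a n k) \<and>
     (\<forall>n\<ge>1. \<exists>k\<ge>1. 0 < a n k) \<and>
     (\<forall>n\<ge>1. \<forall>k\<ge>1. a n k \<le> a n (k + 1))"

definition koethe_space :: "(nat \<Rightarrow> nat \<Rightarrow> real) \<Rightarrow> (nat \<Rightarrow> 'a::{real_normed_field, banach}) set" where
  "koethe_space a = {x. x 0 = 0 \<and> (\<forall>k\<ge>1. (\<lambda>n. norm (x n) * a n k) summable_on {1..})}"

definition koethe_seminorm ::
    "(nat \<Rightarrow> nat \<Rightarrow> real) \<Rightarrow> nat \<Rightarrow> (nat \<Rightarrow> 'a::{real_normed_field, banach}) \<Rightarrow> real" where
  "koethe_seminorm a k x = (\<Sum>\<^sub>\<infinity>n\<in>{1..}. norm (x n) * a n k)"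

(* The locally convex topology on the space defined by its seminorms: the open balls of all
   the seminorms form a subbase. *)
definition koethe_topology ::
    "(nat \<Rightarrow> nat \<Rightarrow> real) \<Rightarrow> (nat \<Rightarrow> 'a::{real_normed_field, banach}) topology" where
  "koethe_topology a = topology_generated_by
     {{y \<in> koethe_space a. koethe_seminorm a k (\<lambda>n. y n - x n) < r} | x k r.
        x \<in> koethe_space a \<and> 1 \<le> k \<and> 0 < r}"

lemma topspace_koethe_topology:
  "topspace (koethe_topology a) = (koethe_space a :: (nat \<Rightarrow> 'a::{real_normed_field, banach}) set)"
    (is "?T = ?K")
proof
  show "?T \<subseteq> ?K"
    unfolding koethe_topology_def topology_generated_by_topspace by blast
  show "?K \<subseteq> ?T"
  proof
    fix x :: "nat \<Rightarrow> 'a"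
    assume x: "x \<in> ?K"
    let ?B = "{y \<in> koethe_space a. koethe_seminorm a 1 (\<lambda>n. y n - x n) < 1}"
    have "x \<in> ?B"
      using x by (simp add: koethe_seminorm_def)
    moreover have "?B \<in> {{y \<in> koethe_space a. koethe_seminorm a k (\<lambda>n. y n - x n) < r} | x k r.
        x \<in> koethe_space a \<and> 1 \<le> k \<and> 0 < r}"
      using x by (intro CollectI exI[of _ x] exI[of _ 1]) simp
    ultimately show "x \<in> ?T"
      unfolding koethe_topology_def topology_generated_by_topspace by (rule UnionI[rotated])
  qed
qed

definition exponent_sequence :: "(nat \<Rightarrow> real) \<Rightarrow> bool" where
  "exponent_sequence \<beta> \<longleftrightarrow>
     (\<forall>n\<ge>1. 0 \<le> \<beta> n) \<and> mono_on {1..} \<beta> \<and> filterlim \<beta> at_top sequentially"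

definition stable_sequence :: "(nat \<Rightarrow> real) \<Rightarrow> bool" where
  "stable_sequence \<beta> \<longleftrightarrow> (\<exists>M. \<forall>n\<ge>1. \<beta> (2 * n) \<le> M * \<beta> n)"

definition power_series_matrix :: "(nat \<Rightarrow> real) \<Rightarrow> nat \<Rightarrow> nat \<Rightarrow> real" where
  "power_series_matrix \<beta> n k = exp (real k * \<beta> n)"

abbreviation power_series_space_infinite ::
    "(nat \<Rightarrow> real) \<Rightarrow> (nat \<Rightarrow> 'a::{real_normed_field, banach}) set" where
  "power_series_space_infinite \<beta> \<equiv> koethe_space (power_series_matrix \<beta>)"

(* (t_0, t_1, ...) regarded as a sequence with indices 1, 2, ... *)
definition one_based :: "(nat \<Rightarrow> 'a::zero) \<Rightarrow> nat \<Rightarrow> 'a" where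
  "one_based \<theta> n = (if n = 0 then 0 else \<theta> (n - 1))"

(* The image of the n-th unit sequence (n >= 1): the n-th column of the Toeplitz matrix. *)
definition toeplitz_column :: "(nat \<Rightarrow> 'a::zero) \<Rightarrow> nat \<Rightarrow> nat \<Rightarrow> 'a" where
  "toeplitz_column \<theta> n j = (if n \<le> j then \<theta> (j - n) else 0)"

definition toeplitz_partial_sum ::
    "(nat \<Rightarrow> 'a::{real_normed_field, banach}) \<Rightarrow> (nat \<Rightarrow> 'a) \<Rightarrow> nat \<Rightarrow> nat \<Rightarrow> 'a" where
  "toeplitz_partial_sum \<theta> x N = (\<lambda>j. \<Sum>n=1..N. x n * toeplitz_column \<theta> n j)"

(* Well-definedness as an operator from the space of the matrix a to the space of b. *)
definition toeplitz_well_defined ::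
    "(nat \<Rightarrow> nat \<Rightarrow> real) \<Rightarrow> (nat \<Rightarrow> nat \<Rightarrow> real) \<Rightarrow> (nat \<Rightarrow> 'a::{real_normed_field, banach}) \<Rightarrow> bool" where
  "toeplitz_well_defined a b \<theta> \<longleftrightarrow>
     (\<forall>n\<ge>1. toeplitz_column \<theta> n \<in> koethe_space b) \<and>
     (\<forall>x \<in> koethe_space a. \<exists>y. limitin (koethe_topology b) (toeplitz_partial_sum \<theta> x) y sequentially)"

(* The sum of the series, taken in the space of b (which is Hausdorff for a Koethe matrix b). *)
definition toeplitz_operator ::
    "(nat \<Rightarrow> nat \<Rightarrow> real) \<Rightarrow> (nat \<Rightarrow> 'a::{real_normed_field, banach}) \<Rightarrow> (nat \<Rightarrow> 'a) \<Rightarrow> nat \<Rightarrow> 'a" where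
  "toeplitz_operator b \<theta> x =
     (THE y. limitin (koethe_topology b) (toeplitz_partial_sum \<theta> x) y sequentially)"

end

theory Submission
  imports Defs
begin

text \<open>
  Everything is decided on the columns \<open>T e\<^sub>n\<close> of the Toeplitz matrix. Since the norms of a Koethe
  space are weighted \<open>\<ell>\<^sup>1\<close>-norms, the ball of a seminorm is essentially spanned by multiples of the unit
  sequences: a matrix maps \<open>K(a)\<close> continuously into \<open>K(b)\<close> as soon as for each \<open>k\<close> there are \<open>m\<close> and \<open>C\<close>
  with \<open>\<parallel>T e\<^sub>n\<parallel>\<^sub>k \<le> C * a\<^sub>n\<^sub>m\<close> for all \<open>n\<close> (lemma \<open>toeplitz_continuous_if_column_bound\<close>), and the
  bound is forced by continuity, because \<open>\<parallel>e\<^sub>n\<parallel>\<^sub>m = a\<^sub>n\<^sub>m\<close> (lemma \<open>toeplitz_column_bound_if_continuous\<close>).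

  What remains is to compare \<open>\<parallel>T e\<^sub>n\<parallel>\<^sub>k = (\<Sum>t. \<bar>\<theta>\<^sub>t\<bar> * exp (k * \<beta>\<^sub>n\<^sub>+\<^sub>t))\<close> with \<open>exp (k * \<beta>\<^sub>n)\<close>.
  Below, a single term with \<open>\<theta>\<^sub>t \<noteq> 0\<close> suffices: as \<open>\<beta>\<close> increases, it is at least
  \<open>\<bar>\<theta>\<^sub>t\<bar> * exp (k * \<beta>\<^sub>n)\<close>; also \<open>\<theta>\<close> lies in the target space since it is the first column.
  Above, stability of \<open>\<beta>\<close> gives \<open>\<beta>\<^sub>n\<^sub>+\<^sub>i \<le> M * (\<beta>\<^sub>n + \<beta>\<^sub>i)\<close>, so the exponential splits into a factor
  depending on \<open>n\<close> and one that is absorbed by a seminorm of \<open>\<theta>\<close> of higher index (lemma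
  \<open>power_series_column_bound\<close>).
\<close>

section \<open>Seminorms of Koethe spaces\<close>

definition koethe_ball ::
    "(nat \<Rightarrow> nat \<Rightarrow> real) \<Rightarrow> nat \<Rightarrow> (nat \<Rightarrow> 'a::{real_normed_field, banach}) \<Rightarrow> real \<Rightarrow> (nat \<Rightarrow> 'a) set" where
  "koethe_ball a k x r = {y \<in> koethe_space a. koethe_seminorm a k (\<lambda>n. y n - x n) < r}"

lemma koethe_matrix_nonneg: "koethe_matrix a \<Longrightarrow> 1 \<le> n \<Longrightarrow> 1 \<le> k \<Longrightarrow> 0 \<le> a n k"
  by (auto simp: koethe_matrix_def)

lemma koethe_matrix_mono:
  assumes "koethe_matrix a" "1 \<le> n" "1 \<le> k" "k \<le> l"
  shows "a n k \<le> a n l"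
  using assms(4)
proof (induction rule: dec_induct)
  case (step i)
  then have "a n i \<le> a n (i + 1)" using assms by (auto simp: koethe_matrix_def)
  then show ?case using step by simp
qed simp

lemma koethe_term_nonneg:
  "koethe_matrix a \<Longrightarrow> n \<in> {1..} \<Longrightarrow> 1 \<le> k \<Longrightarrow> 0 \<le> norm (x n) * a n k"
  by (simp add: koethe_matrix_nonneg)

lemma koethe_space_zero_coord: "x \<in> koethe_space a \<Longrightarrow> x 0 = 0"
  by (simp add: koethe_space_def)

lemma zero_in_koethe_space: "(\<lambda>n. 0) \<in> koethe_space a"
  by (simp add: koethe_space_def)

text \<open>
  This lemma and \<open>koethe_summable_if_bounded\<close>, \<open>koethe_seminorm_le\<close> below reduce all estimates of
  seminorms to estimates of finite sums, in which the order of summation can be exchanged freely.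
\<close>

lemma sum_le_koethe_seminorm:
  assumes "koethe_matrix a" "x \<in> koethe_space a" "1 \<le> k" "finite F" "F \<subseteq> {1..}"
  shows "(\<Sum>n\<in>F. norm (x n) * a n k) \<le> koethe_seminorm a k x"
  unfolding koethe_seminorm_def
proof (rule finite_sum_le_infsum)
  show "(\<lambda>n. norm (x n) * a n k) summable_on {1..}"
    using assms by (simp add: koethe_space_def)
qed (use assms koethe_term_nonneg in blast)+

lemma koethe_seminorm_nonneg:
  assumes "koethe_matrix a" "x \<in> koethe_space a" "1 \<le> k"
  shows "0 \<le> koethe_seminorm a k x"
  using sum_le_koethe_seminorm[OF assms, of "{}"] by simp

lemma coord_le_koethe_seminorm:
  assumes "koethe_matrix a" "x \<in> koethe_space a" "1 \<le> k" "1 \<le> n"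
  shows "norm (x n) * a n k \<le> koethe_seminorm a k x"
  using sum_le_koethe_seminorm[OF assms(1-3), of "{n}"] assms(4) by simp

lemma koethe_summable_if_bounded:
  assumes "koethe_matrix a" "1 \<le> k"
    and "\<And>F. finite F \<Longrightarrow> F \<subseteq> {1..} \<Longrightarrow> (\<Sum>n\<in>F. norm (x n) * a n k) \<le> B"
  shows "(\<lambda>n. norm (x n) * a n k) summable_on {1..}"
proof (rule nonneg_bdd_above_summable_on)
  show "bdd_above (sum (\<lambda>n. norm (x n) * a n k) ` {F. F \<subseteq> {1..} \<and> finite F})"
    using assms(3) by (auto intro!: bdd_aboveI)
qed (use assms koethe_term_nonneg in blast)+

lemma koethe_seminorm_le:
  assumes "x \<in> koethe_space a" "1 \<le> k"
    and "\<And>F. finite F \<Longrightarrow> F \<subseteq> {1..} \<Longrightarrow> (\<Sum>n\<in>F. norm (x n) * a n k) \<le> B"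
  shows "koethe_seminorm a k x \<le> B"
  unfolding koethe_seminorm_def
  by (rule infsum_le_finite_sums) (use assms in \<open>auto simp: koethe_space_def\<close>)

lemma sum_norm_diff_le:
  assumes "koethe_matrix a" "x \<in> koethe_space a" "y \<in> koethe_space a" "1 \<le> k"
    and "finite F" "F \<subseteq> {1..}"
  shows "(\<Sum>n\<in>F. norm (x n - y n) * a n k) \<le> koethe_seminorm a k x + koethe_seminorm a k y"
proof -
  have "(\<Sum>n\<in>F. norm (x n - y n) * a n k) \<le> (\<Sum>n\<in>F. norm (x n) * a n k + norm (y n) * a n k)"
  proof (rule sum_mono)
    fix n assume "n \<in> F"
    then have "norm (x n - y n) * a n k \<le> (norm (x n) + norm (y n)) * a n k"
      using assms by (intro mult_right_mono norm_triangle_ineq4 koethe_matrix_nonneg) auto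
    then show "norm (x n - y n) * a n k \<le> norm (x n) * a n k + norm (y n) * a n k"
      by (simp add: distrib_right)
  qed
  also have "\<dots> = (\<Sum>n\<in>F. norm (x n) * a n k) + (\<Sum>n\<in>F. norm (y n) * a n k)"
    by (rule sum.distrib)
  also have "\<dots> \<le> koethe_seminorm a k x + koethe_seminorm a k y"
    using assms by (intro add_mono sum_le_koethe_seminorm)
  finally show ?thesis .
qed

lemma koethe_space_diff:
  assumes "koethe_matrix a" "x \<in> koethe_space a" "y \<in> koethe_space a"
  shows "(\<lambda>n. x n - y n) \<in> koethe_space a"
  unfolding koethe_space_def mem_Collect_eq
proof (intro conjI allI impI)
  show "x 0 - y 0 = 0" using assms by (simp add: koethe_space_def)
  fix k :: nat assume "1 \<le> k"
  then show "(\<lambda>n. norm (x n - y n) * a n k) summable_on {1..}"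
    by (intro koethe_summable_if_bounded[OF assms(1) _ sum_norm_diff_le[OF assms]])
qed

lemma koethe_seminorm_diff_le:
  assumes "koethe_matrix a" "x \<in> koethe_space a" "y \<in> koethe_space a" "1 \<le> k"
  shows "koethe_seminorm a k (\<lambda>n. x n - y n) \<le> koethe_seminorm a k x + koethe_seminorm a k y"
  using assms by (intro koethe_seminorm_le sum_norm_diff_le koethe_space_diff)

lemma koethe_seminorm_minus_commute:
  "koethe_seminorm a k (\<lambda>n. x n - y n) = koethe_seminorm a k (\<lambda>n. y n - x n)"
  by (simp add: koethe_seminorm_def norm_minus_commute)

lemma koethe_seminorm_triangle:
  assumes "koethe_matrix a" "x \<in> koethe_space a" "y \<in> koethe_space a" "z \<in> koethe_space a" "1 \<le> k"
  shows "koethe_seminorm a k (\<lambda>n. x n - z n)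
           \<le> koethe_seminorm a k (\<lambda>n. x n - y n) + koethe_seminorm a k (\<lambda>n. y n - z n)"
  using koethe_seminorm_diff_le[OF assms(1) koethe_space_diff[OF assms(1-3)]
      koethe_space_diff[OF assms(1,4,3)] assms(5)]
  by (simp add: koethe_seminorm_minus_commute[of a k z y])

lemma koethe_space_scale:
  assumes "x \<in> koethe_space a"
  shows "(\<lambda>n. c * x n) \<in> koethe_space a"
  using assms by (auto simp: koethe_space_def norm_mult mult.assoc intro: summable_on_cmult_right)

lemma koethe_seminorm_scale:
  "koethe_seminorm a k (\<lambda>n. c * x n) = norm c * koethe_seminorm a k x"
  by (simp add: koethe_seminorm_def norm_mult mult.assoc infsum_cmult_right')

lemma koethe_seminorm_mono:
  assumes "koethe_matrix a" "x \<in> koethe_space a" "1 \<le> k" "k \<le> l"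
  shows "koethe_seminorm a k x \<le> koethe_seminorm a l x"
  unfolding koethe_seminorm_def
  by (rule infsum_mono)
    (use assms in \<open>auto simp: koethe_space_def intro!: mult_left_mono koethe_matrix_mono\<close>)

lemma koethe_space_truncate:
  assumes "koethe_matrix a" "x \<in> koethe_space a"
  shows "(\<lambda>n. if P n then x n else 0) \<in> koethe_space a"
  unfolding koethe_space_def mem_Collect_eq
proof (intro conjI allI impI)
  show "(if P 0 then x 0 else 0) = 0" using assms by (simp add: koethe_space_def)
  fix k :: nat assume k: "1 \<le> k"
  show "(\<lambda>n. norm (if P n then x n else 0) * a n k) summable_on {1..}"
  proof (rule summable_on_comparison_test)
    show "(\<lambda>n. norm (x n) * a n k) summable_on {1..}"
      using assms k by (simp add: koethe_space_def)
  qed (use assms k koethe_matrix_nonneg[of a] in auto)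
qed

lemma koethe_seminorm_tail_tendsto:
  assumes a: "koethe_matrix a" and x: "x \<in> koethe_space a" and k: "1 \<le> k"
  shows "(\<lambda>N. koethe_seminorm a k (\<lambda>n. (if n \<le> N then x n else 0) - x n)) \<longlonglongrightarrow> 0"
proof -
  let ?f = "\<lambda>n. norm (x n) * a n k"
  have f: "?f summable_on {1..}" using x k by (simp add: koethe_space_def)
  have tail: "koethe_seminorm a k (\<lambda>n. (if n \<le> N then x n else 0) - x n)
      = koethe_seminorm a k x - sum ?f {1..N}" for N
  proof -
    have "koethe_seminorm a k (\<lambda>n. (if n \<le> N then x n else 0) - x n) = infsum ?f ({1..} - {1..N})"
      unfolding koethe_seminorm_def by (rule infsum_cong_neutral) auto
    also have "\<dots> = infsum ?f {1..} - infsum ?f {1..N}"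
      by (rule infsum_Diff[OF f]) auto
    finally show ?thesis by (simp add: koethe_seminorm_def)
  qed
  have "(\<lambda>n. ?f (Suc n)) sums koethe_seminorm a k x"
  proof -
    have "range Suc = {1..}" by (auto simp: image_iff Suc_le_eq gr0_conv_Suc)
    then have "(?f has_sum koethe_seminorm a k x) (range Suc)"
      unfolding koethe_seminorm_def using has_sum_infsum[OF f] by (simp only:)
    then show ?thesis
      by (subst (asm) has_sum_reindex) (auto simp: o_def dest: has_sum_imp_sums)
  qed
  then have "(\<lambda>N. sum ?f {1..N}) \<longlonglongrightarrow> koethe_seminorm a k x"
    by (simp add: sums_def sum.atLeast1_atMost_eq)
  from tendsto_diff[OF tendsto_const this, of "koethe_seminorm a k x"]
  show ?thesis by (simp add: tail)
qed

lemma koethe_unit_sequence: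
  fixes a :: "nat \<Rightarrow> nat \<Rightarrow> real"
  assumes "1 \<le> n"
  defines "e \<equiv> \<lambda>i. if i = n then 1 else 0 :: 'a::{real_normed_field, banach}"
  shows "e \<in> koethe_space a" and "koethe_seminorm a k e = a n k"
proof -
  have "((\<lambda>i. norm (e i) * a i k) has_sum a n k) {1..}" for k
  proof -
    have "((\<lambda>i. norm (e i) * a i k) has_sum a n k) {n}"
      using has_sum_finite[of "{n}" "\<lambda>i. norm (e i) * a i k"] by (simp add: e_def)
    then show ?thesis
      by (rule has_sum_cong_neutral[THEN iffD1, rotated -1]) (use assms in auto)
  qed
  then show "e \<in> koethe_space a" "koethe_seminorm a k e = a n k"
    using assms by (auto simp: koethe_space_def koethe_seminorm_def summable_on_def infsumI)
qed

section \<open>The topology of a Koethe space\<close>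

lemma openin_koethe_ball:
  assumes "x \<in> koethe_space a" "1 \<le> k" "0 < r"
  shows "openin (koethe_topology a) (koethe_ball a k x r)"
  unfolding koethe_topology_def koethe_ball_def
  by (rule topology_generated_by_Basis) (use assms in blast)

lemma centre_in_koethe_ball: "x \<in> koethe_space a \<Longrightarrow> 0 < r \<Longrightarrow> x \<in> koethe_ball a k x r"
  by (simp add: koethe_ball_def koethe_seminorm_def)

text \<open>
  The balls of all seminorms around all points are only a subbase. They yield the neighbourhoods of
  each point because the seminorms increase with \<open>k\<close>, so that the intersection of finitely
  many balls around \<open>x\<close> contains another one, and because a ball contains a ball around each of its points.
\<close>

lemma openin_koethe_topology_iff:
  assumes a: "koethe_matrix a"
  shows "openin (koethe_topology a) U \<longleftrightarrow>
           U \<subseteq> koethe_space a \<and> (\<forall>x\<in>U. \<exists>k\<ge>1. \<exists>r>0. koethe_ball a k x r \<subseteq> U)"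
proof
  assume U: "openin (koethe_topology a) U"
  have "\<exists>k\<ge>1. \<exists>r>0. koethe_ball a k x r \<subseteq> U" if "x \<in> U" for x
    using U[unfolded koethe_topology_def openin_topology_generated_by_iff] that
  proof (induction arbitrary: x)
    case (Int U V)
    from Int.IH(1)[of x] Int.prems obtain k r where
      U: "1 \<le> k" "0 < r" "koethe_ball a k x r \<subseteq> U" by auto
    from Int.IH(2)[of x] Int.prems obtain l s where
      V: "1 \<le> l" "0 < s" "koethe_ball a l x s \<subseteq> V" by auto
    have "x \<in> koethe_space a"
    proof -
      have "openin (koethe_topology a) U"
        using Int.hyps(1) by (simp add: koethe_topology_def openin_topology_generated_by_iff)
      then show ?thesis
        using Int.prems openin_subset topspace_koethe_topology by blast
    qed
    then have "koethe_ball a (max k l) x (min r s) \<subseteq> koethe_ball a k x r \<inter> koethe_ball a l x s"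
      using koethe_seminorm_mono[OF a koethe_space_diff[OF a], of _ x k "max k l"]
        koethe_seminorm_mono[OF a koethe_space_diff[OF a], of _ x l "max k l"] U(1) V(1)
      by (fastforce simp: koethe_ball_def)
    then have "koethe_ball a (max k l) x (min r s) \<subseteq> U \<inter> V" using U V by blast
    then show ?case using U V by (intro exI[of _ "max k l"] exI[of _ "min r s"] conjI) auto
  next
    case (UN \<U>)
    then show ?case by (meson Sup_upper UnionE subset_trans)
  next
    case (Basis S)
    then obtain z k r where z: "z \<in> koethe_space a" "1 \<le> k" "0 < r"
      and S: "S = koethe_ball a k z r"
      unfolding koethe_ball_def by blast
    define s where "s = r - koethe_seminorm a k (\<lambda>n. x n - z n)"
    have x: "x \<in> koethe_space a" "0 < s" using Basis S by (auto simp: koethe_ball_def s_def)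
    have "koethe_ball a k x s \<subseteq> S"
      using koethe_seminorm_triangle[OF a _ x(1) z(1,2)]
      unfolding S koethe_ball_def s_def by fastforce
    then show ?case using x(2) z(2) by blast
  qed simp
  then show "U \<subseteq> koethe_space a \<and> (\<forall>x\<in>U. \<exists>k\<ge>1. \<exists>r>0. koethe_ball a k x r \<subseteq> U)"
    using openin_subset[OF U] by (simp add: topspace_koethe_topology)
next
  assume *: "U \<subseteq> koethe_space a \<and> (\<forall>x\<in>U. \<exists>k\<ge>1. \<exists>r>0. koethe_ball a k x r \<subseteq> U)"
  show "openin (koethe_topology a) U"
  proof (subst openin_subopen, intro ballI)
    fix x assume "x \<in> U"
    with * obtain k r where "1 \<le> k" "0 < r" "koethe_ball a k x r \<subseteq> U" "x \<in> koethe_space a"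
      by blast
    then show "\<exists>T. openin (koethe_topology a) T \<and> x \<in> T \<and> T \<subseteq> U"
      by (intro exI[of _ "koethe_ball a k x r"] conjI openin_koethe_ball centre_in_koethe_ball)
  qed
qed

lemma limitin_koethe_topologyI:
  assumes a: "koethe_matrix a" and y: "y \<in> koethe_space a"
    and S: "\<And>N. S N \<in> koethe_space a"
    and lim: "\<And>k. 1 \<le> k \<Longrightarrow> (\<lambda>N. koethe_seminorm a k (\<lambda>n. S N n - y n)) \<longlonglongrightarrow> 0"
  shows "limitin (koethe_topology a) S y sequentially"
  unfolding limitin_def
proof (intro conjI allI impI)
  show "y \<in> topspace (koethe_topology a)" using y by (simp add: topspace_koethe_topology)
  fix U assume "openin (koethe_topology a) U \<and> y \<in> U"
  then obtain k r where k: "1 \<le> k" "0 < r" "koethe_ball a k y r \<subseteq> U"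
    using openin_koethe_topology_iff[OF a] by meson
  from order_tendstoD(2)[OF lim[OF k(1)] k(2)]
  show "\<forall>\<^sub>F N in sequentially. S N \<in> U"
    by (rule eventually_mono) (use k S in \<open>auto simp: koethe_ball_def\<close>)
qed

text \<open>
  Coordinates are continuous because every row of a Koethe matrix has a positive entry. Hence limits
  can be identified coordinate by coordinate; in particular they are unique.
\<close>

lemma limitin_koethe_topology_coord:
  assumes a: "koethe_matrix a" and lim: "limitin (koethe_topology a) S y F"
    and n: "1 \<le> n"
  shows "((\<lambda>N. S N n) \<longlongrightarrow> y n) F"
proof (rule tendstoI)
  fix e :: real assume e: "0 < e"
  from a n obtain k where k: "1 \<le> k" "0 < a n k" unfolding koethe_matrix_def by blast
  have y: "y \<in> koethe_space a"
    using limitin_topspace[OF lim] by (simp add: topspace_koethe_topology)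
  have "\<forall>\<^sub>F N in F. S N \<in> koethe_ball a k y (e * a n k)"
    using lim openin_koethe_ball[OF y k(1)] centre_in_koethe_ball[OF y] e k
    unfolding limitin_def by simp
  then show "\<forall>\<^sub>F N in F. dist (S N n) (y n) < e"
  proof (rule eventually_mono)
    fix N assume *: "S N \<in> koethe_ball a k y (e * a n k)"
    then have "norm (S N n - y n) * a n k \<le> koethe_seminorm a k (\<lambda>i. S N i - y i)"
      using coord_le_koethe_seminorm[OF a koethe_space_diff[OF a _ y] k(1) n, of "S N"]
      by (simp add: koethe_ball_def)
    also have "\<dots> < e * a n k" using * by (simp add: koethe_ball_def)
    finally show "dist (S N n) (y n) < e" using k by (simp add: dist_norm)
  qed
qed

text \<open>
  The classical criterion for linear maps between locally convex spaces: continuity is domination of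
  each seminorm of the image by a seminorm of the argument. Additivity serves to pass from
  neighbourhoods of zero to those of other points; the converse below rests on homogeneity.
\<close>

lemma continuous_map_koethe_topologyI:
  fixes T :: "(nat \<Rightarrow> 'a::{real_normed_field, banach}) \<Rightarrow> nat \<Rightarrow> 'b::{real_normed_field, banach}"
  assumes a: "koethe_matrix a" and b: "koethe_matrix b"
    and diff: "\<And>x y. T (\<lambda>n. x n - y n) = (\<lambda>n. T x n - T y n)"
    and into: "\<And>x. x \<in> koethe_space a \<Longrightarrow> T x \<in> koethe_space b"
    and bound: "\<And>k. 1 \<le> k \<Longrightarrow> \<exists>m\<ge>1. \<exists>C>0. \<forall>x\<in>koethe_space a.
                  koethe_seminorm b k (T x) \<le> C * koethe_seminorm a m x"
  shows "continuous_map (koethe_topology a) (koethe_topology b) T"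
  unfolding continuous_map_def topspace_koethe_topology
proof (intro conjI allI impI)
  show "T \<in> koethe_space a \<rightarrow> koethe_space b" using into by blast
  fix V :: "(nat \<Rightarrow> 'b) set" assume V: "openin (koethe_topology b) V"
  show "openin (koethe_topology a) {x \<in> koethe_space a. T x \<in> V}"
    unfolding openin_koethe_topology_iff[OF a]
  proof (intro conjI ballI)
    fix x assume "x \<in> {x \<in> koethe_space a. T x \<in> V}"
    then have x: "x \<in> koethe_space a" "T x \<in> V" by auto
    with V obtain k r where k: "1 \<le> k" "0 < r" "koethe_ball b k (T x) r \<subseteq> V"
      using openin_koethe_topology_iff[OF b] by meson
    from bound[OF k(1)] obtain m C where m: "1 \<le> m" "0 < C"
      and C: "\<And>x. x \<in> koethe_space a \<Longrightarrow> koethe_seminorm b k (T x) \<le> C * koethe_seminorm a m x"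
      by blast
    have "T y \<in> V" if y: "y \<in> koethe_ball a m x (r / C)" for y
    proof -
      have ya: "y \<in> koethe_space a" using y by (simp add: koethe_ball_def)
      have "koethe_seminorm b k (\<lambda>n. T y n - T x n) \<le> C * koethe_seminorm a m (\<lambda>n. y n - x n)"
        using C[OF koethe_space_diff[OF a ya x(1)]] by (simp add: diff)
      also have "\<dots> < r" using y m by (simp add: koethe_ball_def field_simps)
      finally show ?thesis using k(3) into[OF ya] by (auto simp: koethe_ball_def)
    qed
    then have "koethe_ball a m x (r / C) \<subseteq> {x \<in> koethe_space a. T x \<in> V}"
      by (auto simp: koethe_ball_def)
    then show "\<exists>k\<ge>1. \<exists>r>0. koethe_ball a k x r \<subseteq> {x \<in> koethe_space a. T x \<in> V}"
      using m k(2) by (intro exI[of _ m] exI[of _ "r / C"] conjI) auto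
  qed auto
qed

lemma continuous_map_koethe_topology_bounded:
  fixes T :: "(nat \<Rightarrow> 'a::{real_normed_field, banach}) \<Rightarrow> nat \<Rightarrow> 'a"
  assumes a: "koethe_matrix a" and b: "koethe_matrix b"
    and scale: "\<And>c x. T (\<lambda>n. c * x n) = (\<lambda>n. c * T x n)"
    and cont: "continuous_map (koethe_topology a) (koethe_topology b) T"
    and k: "1 \<le> k"
  shows "\<exists>m\<ge>1. \<exists>C>0. \<forall>x\<in>koethe_space a. koethe_seminorm b k (T x) \<le> C * koethe_seminorm a m x"
proof -
  have T0: "T (\<lambda>n. 0) = (\<lambda>n. 0)" using scale[of 0] by simp
  let ?V = "koethe_ball b k (\<lambda>n. 0) 1"
  have "openin (koethe_topology a) {x \<in> koethe_space a. T x \<in> ?V}"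
    using openin_continuous_map_preimage[OF cont openin_koethe_ball[OF zero_in_koethe_space k]]
    by (simp add: topspace_koethe_topology)
  moreover have "(\<lambda>n. 0) \<in> {x \<in> koethe_space a. T x \<in> ?V}"
    using centre_in_koethe_ball[OF zero_in_koethe_space, of 1 b k]
    by (simp add: T0 zero_in_koethe_space)
  ultimately obtain m r where m: "1 \<le> m" "0 < r"
    and sub: "koethe_ball a m (\<lambda>n. 0) r \<subseteq> {x \<in> koethe_space a. T x \<in> ?V}"
    unfolding openin_koethe_topology_iff[OF a] by blast
  have "koethe_seminorm b k (T x) \<le> 2 / r * koethe_seminorm a m x" if x: "x \<in> koethe_space a" for x
  proof (rule ccontr)
    let ?p = "koethe_seminorm a m x" and ?q = "koethe_seminorm b k (T x)"
    assume "\<not> ?thesis"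
    then have less: "2 / r * ?p < ?q" by simp
    have p: "0 \<le> ?p" using koethe_seminorm_nonneg[OF a x m(1)] .
    have q: "0 < ?q" using less p m(2) by (smt (verit) divide_nonneg_pos mult_nonneg_nonneg)
    \<comment> \<open>The multiple of \<open>x\<close> whose image has seminorm 1 still lies in the ball of radius \<open>r\<close>.\<close>
    define c :: 'a where "c = of_real (1 / ?q)"
    have c: "norm c = 1 / ?q" using q by (simp add: c_def del: of_real_divide)
    have "2 * ?p < r * ?q" using less m(2) by (simp add: field_simps)
    then have "norm c * ?p < r" using p q m(2) by (simp add: c field_simps)
    then have "(\<lambda>n. c * x n) \<in> koethe_ball a m (\<lambda>n. 0) r"
      using koethe_space_scale[OF x, of c] by (simp add: koethe_ball_def koethe_seminorm_scale)
    then have "T (\<lambda>n. c * x n) \<in> ?V" using sub by blast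
    then show False using q by (simp add: koethe_ball_def scale koethe_seminorm_scale c)
  qed
  then show ?thesis using m by (intro exI[of _ m] exI[of _ "2 / r"] conjI) auto
qed

section \<open>Toeplitz columns in a stable power series space\<close>

lemma power_series_matrix_koethe:
  assumes "exponent_sequence \<beta>"
  shows "koethe_matrix (power_series_matrix \<beta>)"
  using assms
  by (auto simp: koethe_matrix_def power_series_matrix_def exponent_sequence_def algebra_simps)

text \<open>
  Since \<open>n + i \<le> 2 * max n i\<close>, control of \<open>\<beta>\<close> under doubling of the index is control under addition
  of indices.
\<close>

lemma stable_sequence_add:
  assumes "exponent_sequence \<beta>" "stable_sequence \<beta>"
  obtains M where "0 \<le> M" "\<And>n i. 1 \<le> n \<Longrightarrow> 1 \<le> i \<Longrightarrow> \<beta> (n + i) \<le> M * (\<beta> n + \<beta> i)"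
proof -
  from assms(2) obtain M where M: "\<And>n. 1 \<le> n \<Longrightarrow> \<beta> (2 * n) \<le> M * \<beta> n"
    unfolding stable_sequence_def by blast
  have nonneg: "\<And>n. 1 \<le> n \<Longrightarrow> 0 \<le> \<beta> n" and mono: "mono_on {1..} \<beta>"
    using assms(1) by (auto simp: exponent_sequence_def)
  have "\<beta> (n + i) \<le> max M 0 * (\<beta> n + \<beta> i)" if "1 \<le> n" "1 \<le> i" for n i
  proof -
    have "\<beta> (n + i) \<le> \<beta> (2 * max n i)" using that by (intro mono_onD[OF mono]) auto
    also have "\<dots> \<le> M * \<beta> (max n i)" using that by (intro M) auto
    also have "\<dots> \<le> max M 0 * \<beta> (max n i)" using that by (intro mult_right_mono nonneg) auto
    also have "\<dots> \<le> max M 0 * (\<beta> n + \<beta> i)"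
      using that nonneg[of n] nonneg[of i] by (intro mult_left_mono) (auto simp: max_def)
    finally show ?thesis .
  qed
  then show ?thesis by (intro that[of "max M 0"]) auto
qed

text \<open>
  The \<open>j\<close>-th entry of the column \<open>n\<close> is the \<open>i\<close>-th one of \<open>\<theta>\<close>, where \<open>i = j - n + 1\<close> because \<open>\<theta>\<close>
  is counted from 1. Its weight \<open>exp (k * \<beta>\<^sub>j)\<close> is at most \<open>exp (k * M * \<beta>\<^sub>n) * exp (k * M * \<beta>\<^sub>i)\<close>
  by stability, and the sum over \<open>i\<close> of the entries of \<open>\<theta>\<close> with the second factors as weights is
  bounded by a seminorm of \<open>\<theta>\<close>.
\<close>

lemma power_series_column_bound:
  fixes \<theta> :: "nat \<Rightarrow> 'a::{real_normed_field, banach}"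
  assumes \<beta>: "exponent_sequence \<beta>" "stable_sequence \<beta>"
    and \<theta>: "one_based \<theta> \<in> power_series_space_infinite \<beta>"
    and k: "1 \<le> k"
  obtains l B where "1 \<le> l" "0 < B"
    "\<And>n F. 1 \<le> n \<Longrightarrow> finite F \<Longrightarrow> F \<subseteq> {1..} \<Longrightarrow>
       (\<Sum>j\<in>F. norm (toeplitz_column \<theta> n j) * power_series_matrix \<beta> j k) \<le> B * exp (real l * \<beta> n)"
proof -
  obtain M where M: "0 \<le> M"
    "\<And>n i. 1 \<le> n \<Longrightarrow> 1 \<le> i \<Longrightarrow> \<beta> (n + i) \<le> M * (\<beta> n + \<beta> i)"
    using stable_sequence_add[OF \<beta>] by blast
  have nonneg: "\<And>n. 1 \<le> n \<Longrightarrow> 0 \<le> \<beta> n" and mono: "mono_on {1..} \<beta>"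
    using \<beta>(1) by (auto simp: exponent_sequence_def)
  \<comment> \<open>A valid index of a seminorm that is at least \<open>k * M\<close>; adding 1 covers the case \<open>M = 0\<close>.\<close>
  define l where "l = nat \<lceil>real k * M\<rceil> + 1"
  have l: "1 \<le> l" "real k * M \<le> real l" unfolding l_def by linarith+
  let ?b = "power_series_matrix \<beta>"
  note b = power_series_matrix_koethe[OF \<beta>(1)]
  let ?s = "koethe_seminorm ?b l (one_based \<theta>)"
  have s: "0 \<le> ?s" by (rule koethe_seminorm_nonneg[OF b \<theta> l(1)])
  have "(\<Sum>j\<in>F. norm (toeplitz_column \<theta> n j) * ?b j k) \<le> (?s + 1) * exp (real l * \<beta> n)"
    if n: "1 \<le> n" and F: "finite F" "F \<subseteq> {1..}" for n F
  proof -
    let ?G = "F \<inter> {n..}"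
    let ?i = "\<lambda>j. j - n + 1"
    have inj: "inj_on ?i ?G" by (auto simp: inj_on_def)
    have "(\<Sum>j\<in>F. norm (toeplitz_column \<theta> n j) * ?b j k)
            = (\<Sum>j\<in>?G. norm (toeplitz_column \<theta> n j) * ?b j k)"
      by (rule sum.mono_neutral_right) (use F in \<open>auto simp: toeplitz_column_def\<close>)
    also have "\<dots> \<le> (\<Sum>j\<in>?G. exp (real l * \<beta> n) * (norm (one_based \<theta> (?i j)) * ?b (?i j) l))"
    proof (rule sum_mono)
      fix j assume j: "j \<in> ?G"
      \<comment> \<open>Here \<open>n + i = j + 1\<close>; monotonicity of \<open>\<beta>\<close> takes care of the shift by 1.\<close>
      have "\<beta> j \<le> \<beta> (n + ?i j)" using n j by (intro mono_onD[OF mono]) auto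
      also have "\<dots> \<le> M * (\<beta> n + \<beta> (?i j))" using n by (intro M) auto
      finally have "real k * \<beta> j \<le> real k * (M * (\<beta> n + \<beta> (?i j)))"
        by (intro mult_left_mono) auto
      also have "\<dots> \<le> real l * (\<beta> n + \<beta> (?i j))"
        unfolding mult.assoc[symmetric]
        using n by (intro mult_right_mono l add_nonneg_nonneg nonneg) auto
      finally have "?b j k \<le> exp (real l * \<beta> n) * ?b (?i j) l"
        by (simp add: power_series_matrix_def exp_add[symmetric] distrib_left)
      then have "norm (\<theta> (j - n)) * ?b j k
          \<le> norm (\<theta> (j - n)) * (exp (real l * \<beta> n) * ?b (?i j) l)"
        by (intro mult_left_mono) auto
      then show "norm (toeplitz_column \<theta> n j) * ?b j k
          \<le> exp (real l * \<beta> n) * (norm (one_based \<theta> (?i j)) * ?b (?i j) l)"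
        using j by (simp add: toeplitz_column_def one_based_def mult_ac)
    qed
    also have "\<dots> = exp (real l * \<beta> n) * (\<Sum>i\<in>?i ` ?G. norm (one_based \<theta> i) * ?b i l)"
      by (simp only: sum.reindex[OF inj] sum_distrib_left o_def)
    also have "\<dots> \<le> exp (real l * \<beta> n) * ?s"
      by (intro mult_left_mono sum_le_koethe_seminorm b \<theta> l) (use F in auto)
    also have "\<dots> \<le> (?s + 1) * exp (real l * \<beta> n)" by (simp add: algebra_simps)
    finally show ?thesis .
  qed
  \<comment> \<open>The seminorm of \<open>\<theta>\<close> is increased by 1 because the constant has to be positive.\<close>
  then show ?thesis using l(1) s by (intro that[of l "?s + 1"]) auto
qed

lemma toeplitz_column_in_power_series_space:
  assumes "exponent_sequence \<beta>" "stable_sequence \<beta>"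
    and "one_based \<theta> \<in> power_series_space_infinite \<beta>" and n: "1 \<le> n"
  shows "toeplitz_column \<theta> n \<in> power_series_space_infinite \<beta>"
  unfolding koethe_space_def mem_Collect_eq
proof (intro conjI allI impI)
  show "toeplitz_column \<theta> n 0 = 0" using n by (simp add: toeplitz_column_def)
  fix k :: nat assume k: "1 \<le> k"
  obtain l B where "\<And>F. finite F \<Longrightarrow> F \<subseteq> {1..} \<Longrightarrow>
      (\<Sum>j\<in>F. norm (toeplitz_column \<theta> n j) * power_series_matrix \<beta> j k) \<le> B * exp (real l * \<beta> n)"
    by (rule power_series_column_bound[OF assms(1-3) k]) (use n in blast)
  then show "(\<lambda>j. norm (toeplitz_column \<theta> n j) * power_series_matrix \<beta> j k) summable_on {1..}"
    by (intro koethe_summable_if_bounded[OF power_series_matrix_koethe[OF assms(1)] k])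
qed

section \<open>Toeplitz operators between Koethe spaces\<close>

text \<open>
  The product of the lower triangular matrix with \<open>x\<close>. It needs no convergence, as only the columns
  \<open>n \<le> j\<close> contribute to the coordinate \<open>j\<close>; so it exists for all sequences, and it is the only candidate
  for the sum of the series of columns.
\<close>

definition toeplitz_apply ::
    "(nat \<Rightarrow> 'a::{real_normed_field, banach}) \<Rightarrow> (nat \<Rightarrow> 'a) \<Rightarrow> nat \<Rightarrow> 'a" where
  "toeplitz_apply \<theta> x j = (\<Sum>n=1..j. x n * toeplitz_column \<theta> n j)"

lemma toeplitz_apply_diff:
  "toeplitz_apply \<theta> (\<lambda>n. x n - y n) = (\<lambda>n. toeplitz_apply \<theta> x n - toeplitz_apply \<theta> y n)"
  by (simp add: toeplitz_apply_def fun_eq_iff left_diff_distrib sum_subtractf)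

lemma toeplitz_apply_scale:
  "toeplitz_apply \<theta> (\<lambda>n. c * x n) = (\<lambda>n. c * toeplitz_apply \<theta> x n)"
  by (simp add: toeplitz_apply_def fun_eq_iff mult.assoc sum_distrib_left)

lemma toeplitz_partial_sum_coord:
  assumes "j \<le> N"
  shows "toeplitz_partial_sum \<theta> x N j = toeplitz_apply \<theta> x j"
  unfolding toeplitz_partial_sum_def toeplitz_apply_def
  by (rule sum.mono_neutral_right) (use assms in \<open>auto simp: toeplitz_column_def\<close>)

text \<open>
  Partial sums are values of the operator at truncated sequences, so that their convergence follows
  from an estimate of the operator and convergence of the truncations.
\<close>

lemma toeplitz_partial_sum_eq_apply:
  "toeplitz_partial_sum \<theta> x N = toeplitz_apply \<theta> (\<lambda>n. if n \<le> N then x n else 0)"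
proof
  fix j
  have "toeplitz_partial_sum \<theta> x N j = (\<Sum>n\<in>{1..N} \<inter> {1..j}. x n * toeplitz_column \<theta> n j)"
    unfolding toeplitz_partial_sum_def
    by (rule sum.mono_neutral_right) (auto simp: toeplitz_column_def)
  also have "\<dots> = toeplitz_apply \<theta> (\<lambda>n. if n \<le> N then x n else 0) j"
    unfolding toeplitz_apply_def by (rule sum.mono_neutral_cong_left) auto
  finally show "toeplitz_partial_sum \<theta> x N j
      = toeplitz_apply \<theta> (\<lambda>n. if n \<le> N then x n else 0) j" .
qed

lemma toeplitz_limit_eq_apply:
  assumes b: "koethe_matrix b"
    and lim: "limitin (koethe_topology b) (toeplitz_partial_sum \<theta> x) y sequentially"
  shows "y = toeplitz_apply \<theta> x"
proof
  fix j
  show "y j = toeplitz_apply \<theta> x j"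
  proof (cases "j = 0")
    case True
    then show ?thesis
      using limitin_topspace[OF lim]
      by (simp add: topspace_koethe_topology koethe_space_zero_coord toeplitz_apply_def)
  next
    case False
    then have "(\<lambda>N. toeplitz_partial_sum \<theta> x N j) \<longlonglongrightarrow> y j"
      by (intro limitin_koethe_topology_coord[OF b lim]) simp
    moreover have "(\<lambda>N. toeplitz_partial_sum \<theta> x N j) \<longlonglongrightarrow> toeplitz_apply \<theta> x j"
      by (rule tendsto_eventually)
        (auto simp: eventually_sequentially intro: toeplitz_partial_sum_coord)
    ultimately show ?thesis by (rule LIMSEQ_unique)
  qed
qed

lemma toeplitz_operator_eq_apply:
  assumes "koethe_matrix b" "toeplitz_well_defined a b \<theta>" "x \<in> koethe_space a"
  shows "toeplitz_operator b \<theta> x = toeplitz_apply \<theta> x"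
proof -
  from assms(2,3) obtain y where "limitin (koethe_topology b) (toeplitz_partial_sum \<theta> x) y sequentially"
    unfolding toeplitz_well_defined_def by blast
  then show ?thesis
    unfolding toeplitz_operator_def
    using toeplitz_limit_eq_apply[OF assms(1)] by (metis the_equality)
qed

text \<open>
  The triangle inequality followed by an exchange of the sums over rows and columns.
\<close>

lemma sum_norm_toeplitz_apply_le:
  assumes a: "koethe_matrix a" and b: "koethe_matrix b" and x: "x \<in> koethe_space a"
    and k: "1 \<le> k" and m: "1 \<le> m" and C: "0 \<le> C"
    and col_in: "\<And>n. 1 \<le> n \<Longrightarrow> toeplitz_column \<theta> n \<in> koethe_space b"
    and col: "\<And>n. 1 \<le> n \<Longrightarrow> koethe_seminorm b k (toeplitz_column \<theta> n) \<le> C * a n m"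
    and F: "finite F" "F \<subseteq> {1..}"
  shows "(\<Sum>j\<in>F. norm (toeplitz_apply \<theta> x j) * b j k) \<le> C * koethe_seminorm a m x"
proof -
  obtain N where N: "F \<subseteq> {..N}" using F(1) by (meson finite_nat_iff_bounded_le)
  have "(\<Sum>j\<in>F. norm (toeplitz_apply \<theta> x j) * b j k)
          \<le> (\<Sum>j\<in>F. \<Sum>n=1..N. norm (x n) * (norm (toeplitz_column \<theta> n j) * b j k))"
  proof (rule sum_mono)
    fix j assume j: "j \<in> F"
    then have "norm (toeplitz_apply \<theta> x j) = norm (\<Sum>n=1..N. x n * toeplitz_column \<theta> n j)"
      using toeplitz_partial_sum_coord[of j N \<theta> x] N
      by (auto simp: toeplitz_partial_sum_def)
    also have "\<dots> \<le> (\<Sum>n=1..N. norm (x n) * norm (toeplitz_column \<theta> n j))"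
      by (simp add: sum_norm_le norm_mult)
    finally have "norm (toeplitz_apply \<theta> x j) * b j k
        \<le> (\<Sum>n=1..N. norm (x n) * norm (toeplitz_column \<theta> n j)) * b j k"
      using koethe_matrix_nonneg[OF b _ k] F j by (intro mult_right_mono) auto
    then show "norm (toeplitz_apply \<theta> x j) * b j k
        \<le> (\<Sum>n=1..N. norm (x n) * (norm (toeplitz_column \<theta> n j) * b j k))"
      by (simp add: sum_distrib_right mult.assoc)
  qed
  also have "\<dots> = (\<Sum>n=1..N. norm (x n) * (\<Sum>j\<in>F. norm (toeplitz_column \<theta> n j) * b j k))"
    by (subst sum.swap) (simp add: sum_distrib_left)
  also have "\<dots> \<le> (\<Sum>n=1..N. norm (x n) * (C * a n m))"
    by (intro sum_mono mult_left_mono order_trans[OF sum_le_koethe_seminorm col] b col_in k F) auto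
  also have "\<dots> = C * (\<Sum>n=1..N. norm (x n) * a n m)"
    by (simp add: sum_distrib_left mult_ac)
  also have "\<dots> \<le> C * koethe_seminorm a m x"
    by (intro mult_left_mono sum_le_koethe_seminorm a x m C) auto
  finally show ?thesis .
qed

text \<open>
  The column bound extends to all \<open>x\<close> by summation, which gives the estimate
  \<open>\<parallel>T x\<parallel>\<^sub>k \<le> C * \<parallel>x\<parallel>\<^sub>m\<close>. Applied to \<open>x\<close> it shows continuity; applied to the tails of \<open>x\<close> it shows
  that the series of columns converges to \<open>T x\<close>.
\<close>

lemma toeplitz_continuous_if_column_bound:
  assumes a: "koethe_matrix a" and b: "koethe_matrix b"
    and col_in: "\<And>n. 1 \<le> n \<Longrightarrow> toeplitz_column \<theta> n \<in> koethe_space b"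
    and col: "\<And>k. 1 \<le> k \<Longrightarrow> \<exists>m\<ge>1. \<exists>C>0. \<forall>n\<ge>1.
                koethe_seminorm b k (toeplitz_column \<theta> n) \<le> C * a n m"
  shows "toeplitz_well_defined a b \<theta>"
    and "continuous_map (koethe_topology a) (koethe_topology b) (toeplitz_operator b \<theta>)"
proof -
  let ?T = "toeplitz_apply \<theta>"
  have into: "?T x \<in> koethe_space b" if x: "x \<in> koethe_space a" for x
    unfolding koethe_space_def mem_Collect_eq
  proof (intro conjI allI impI)
    show "?T x 0 = 0" by (simp add: toeplitz_apply_def)
    fix k :: nat assume k: "1 \<le> k"
    from col[OF k] obtain m C where m: "1 \<le> m" "0 < C"
      and C: "\<And>n. 1 \<le> n \<Longrightarrow> koethe_seminorm b k (toeplitz_column \<theta> n) \<le> C * a n m" by blast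
    show "(\<lambda>n. norm (?T x n) * b n k) summable_on {1..}"
      by (rule koethe_summable_if_bounded[OF b k
            sum_norm_toeplitz_apply_le[OF a b x k m(1) less_imp_le[OF m(2)] col_in C]])
  qed
  have bound: "\<exists>m\<ge>1. \<exists>C>0. \<forall>x\<in>koethe_space a.
      koethe_seminorm b k (?T x) \<le> C * koethe_seminorm a m x" if k: "1 \<le> k" for k
  proof -
    from col[OF k] obtain m C where m: "1 \<le> m" "0 < C"
      and C: "\<And>n. 1 \<le> n \<Longrightarrow> koethe_seminorm b k (toeplitz_column \<theta> n) \<le> C * a n m" by blast
    have "koethe_seminorm b k (?T x) \<le> C * koethe_seminorm a m x" if x: "x \<in> koethe_space a" for x
      by (rule koethe_seminorm_le[OF into[OF x] k
            sum_norm_toeplitz_apply_le[OF a b x k m(1) less_imp_le[OF m(2)] col_in C]])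
    then show ?thesis using m by blast
  qed
  have "limitin (koethe_topology b) (toeplitz_partial_sum \<theta> x) (?T x) sequentially"
    if x: "x \<in> koethe_space a" for x
  proof -
    let ?x = "\<lambda>N n. if n \<le> N then x n else 0"
    have xN: "?x N \<in> koethe_space a" for N by (rule koethe_space_truncate[OF a x])
    have d: "(\<lambda>n. ?x N n - x n) \<in> koethe_space a" for N by (rule koethe_space_diff[OF a xN x])
    have S: "toeplitz_partial_sum \<theta> x N \<in> koethe_space b" for N
      unfolding toeplitz_partial_sum_eq_apply by (rule into[OF xN])
    have "(\<lambda>N. koethe_seminorm b k (\<lambda>n. toeplitz_partial_sum \<theta> x N n - ?T x n)) \<longlonglongrightarrow> 0"
      if k: "1 \<le> k" for k
    proof -
      from bound[OF k] obtain m C where m: "1 \<le> m"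
        and C: "\<And>x. x \<in> koethe_space a \<Longrightarrow> koethe_seminorm b k (?T x) \<le> C * koethe_seminorm a m x"
        by blast
      show ?thesis
        unfolding toeplitz_partial_sum_eq_apply toeplitz_apply_diff[symmetric]
      proof (rule tendsto_sandwich[OF _ _ tendsto_const])
        show "(\<lambda>N. C * koethe_seminorm a m (\<lambda>n. ?x N n - x n)) \<longlonglongrightarrow> 0"
          using tendsto_mult_left[OF koethe_seminorm_tail_tendsto[OF a x m], of C] by simp
      qed (use koethe_seminorm_nonneg[OF b into[OF d] k] C[OF d] in auto)
    qed
    then show ?thesis by (rule limitin_koethe_topologyI[OF b into[OF x] S])
  qed
  with col_in show wd: "toeplitz_well_defined a b \<theta>"
    unfolding toeplitz_well_defined_def by blast
  show "continuous_map (koethe_topology a) (koethe_topology b) (toeplitz_operator b \<theta>)"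
  proof (rule continuous_map_eq)
    show "continuous_map (koethe_topology a) (koethe_topology b) ?T"
      by (intro continuous_map_koethe_topologyI a b toeplitz_apply_diff into bound)
  qed (simp add: topspace_koethe_topology toeplitz_operator_eq_apply[OF b wd])
qed

lemma toeplitz_apply_unit:
  assumes "1 \<le> n"
  shows "toeplitz_apply \<theta> (\<lambda>i. if i = n then 1 else 0) = toeplitz_column \<theta> n"
proof
  fix j
  show "toeplitz_apply \<theta> (\<lambda>i. if i = n then 1 else 0) j = toeplitz_column \<theta> n j"
    using assms by (simp add: toeplitz_apply_def toeplitz_column_def if_distrib[of "\<lambda>c. c * _"] sum.delta
        cong: if_cong)
qed

lemma toeplitz_column_one: "toeplitz_column \<theta> 1 = one_based \<theta>"
  by (auto simp: toeplitz_column_def one_based_def fun_eq_iff)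

text \<open>
  Continuity dominates \<open>\<parallel>T x\<parallel>\<^sub>k\<close> by some \<open>C * \<parallel>x\<parallel>\<^sub>m\<close>; the unit sequences turn this into a statement on
  columns and matrix entries.
\<close>

lemma toeplitz_column_bound_if_continuous:
  assumes a: "koethe_matrix a" and b: "koethe_matrix b"
    and wd: "toeplitz_well_defined a b \<theta>"
    and cont: "continuous_map (koethe_topology a) (koethe_topology b) (toeplitz_operator b \<theta>)"
    and k: "1 \<le> k"
  shows "\<exists>m\<ge>1. \<exists>C>0. \<forall>n\<ge>1. koethe_seminorm b k (toeplitz_column \<theta> n) \<le> C * a n m"
proof -
  have "continuous_map (koethe_topology a) (koethe_topology b) (toeplitz_apply \<theta>)"
    by (rule continuous_map_eq[OF cont])
      (simp add: topspace_koethe_topology toeplitz_operator_eq_apply[OF b wd])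
  from continuous_map_koethe_topology_bounded[OF a b toeplitz_apply_scale this k]
  obtain m C where m: "1 \<le> m" "0 < C" and C: "\<And>x. x \<in> koethe_space a \<Longrightarrow>
      koethe_seminorm b k (toeplitz_apply \<theta> x) \<le> C * koethe_seminorm a m x" by blast
  have "koethe_seminorm b k (toeplitz_column \<theta> n) \<le> C * a n m" if "1 \<le> n" for n
    using C[OF koethe_unit_sequence(1)[OF that]]
    by (simp only: toeplitz_apply_unit[OF that] koethe_unit_sequence(2)[OF that])
  then show ?thesis using m by blast
qed

section \<open>Toeplitz operators into power series spaces of infinite type\<close>

theorem theorem3p6:
  fixes \<beta> :: "nat \<Rightarrow> real" and a :: "nat \<Rightarrow> nat \<Rightarrow> real"
    and \<theta> :: "nat \<Rightarrow> 'a::{real_normed_field, banach}"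
  assumes "exponent_sequence \<beta>" and "stable_sequence \<beta>"
    and "koethe_matrix a"
    and "infinite {t. \<theta> t \<noteq> 0}"
  shows "(toeplitz_well_defined a (power_series_matrix \<beta>) \<theta> \<and>
          continuous_map (koethe_topology a) (koethe_topology (power_series_matrix \<beta>))
            (toeplitz_operator (power_series_matrix \<beta>) \<theta>))
     \<longleftrightarrow>
         (one_based \<theta> \<in> power_series_space_infinite \<beta> \<and>
          (\<forall>k\<ge>1. \<exists>m\<ge>1. \<exists>C>0. \<forall>n\<ge>1. exp (real k * \<beta> n) \<le> C * a n m))"
proof (intro iffI conjI allI impI; elim conjE)
  let ?b = "power_series_matrix \<beta>"
  note b = power_series_matrix_koethe[OF assms(1)]
  {
    assume wd: "toeplitz_well_defined a ?b \<theta>"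
      and cont: "continuous_map (koethe_topology a) (koethe_topology ?b) (toeplitz_operator ?b \<theta>)"
    have col: "toeplitz_column \<theta> n \<in> koethe_space ?b" if "1 \<le> n" for n
      using wd that by (simp add: toeplitz_well_defined_def)
    show "one_based \<theta> \<in> power_series_space_infinite \<beta>"
      using col[of 1] by (simp only: toeplitz_column_one)
    fix k :: nat assume k: "1 \<le> k"
    \<comment> \<open>One nonzero entry of \<open>\<theta>\<close> bounds every column from below, in its row \<open>n + t\<close>.\<close>
    from assms(4) obtain t where t: "\<theta> t \<noteq> 0" using not_finite_existsD by auto
    from toeplitz_column_bound_if_continuous[OF assms(3) b wd cont k]
    obtain m C where m: "1 \<le> m" "0 < C"
      and C: "\<And>n. 1 \<le> n \<Longrightarrow> koethe_seminorm ?b k (toeplitz_column \<theta> n) \<le> C * a n m" by blast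
    have "exp (real k * \<beta> n) \<le> C / norm (\<theta> t) * a n m" if n: "1 \<le> n" for n
    proof -
      have "\<beta> n \<le> \<beta> (n + t)"
        using assms(1) n by (intro mono_onD[of "{1..}" \<beta>]) (auto simp: exponent_sequence_def)
      then have "norm (\<theta> t) * exp (real k * \<beta> n) \<le> norm (\<theta> t) * exp (real k * \<beta> (n + t))"
        by (intro mult_left_mono) (auto intro: mult_left_mono)
      also have "\<dots> = norm (toeplitz_column \<theta> n (n + t)) * ?b (n + t) k"
        by (simp add: toeplitz_column_def power_series_matrix_def)
      also have "\<dots> \<le> koethe_seminorm ?b k (toeplitz_column \<theta> n)"
        using n by (intro coord_le_koethe_seminorm b col k) auto
      also have "\<dots> \<le> C * a n m" by (rule C[OF n])
      finally show ?thesis using t by (simp add: field_simps)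
    qed
    then show "\<exists>m\<ge>1. \<exists>C>0. \<forall>n\<ge>1. exp (real k * \<beta> n) \<le> C * a n m"
      using m t by (intro exI[of _ m] exI[of _ "C / norm (\<theta> t)"] conjI) auto
  }
  assume \<theta>: "one_based \<theta> \<in> power_series_space_infinite \<beta>"
    and dom: "\<forall>k\<ge>1. \<exists>m\<ge>1. \<exists>C>0. \<forall>n\<ge>1. exp (real k * \<beta> n) \<le> C * a n m"
  have col_in: "toeplitz_column \<theta> n \<in> koethe_space ?b" if "1 \<le> n" for n
    using toeplitz_column_in_power_series_space[OF assms(1,2) \<theta> that] .
  have "\<exists>m\<ge>1. \<exists>C>0. \<forall>n\<ge>1. koethe_seminorm ?b k (toeplitz_column \<theta> n) \<le> C * a n m"
    if k: "1 \<le> k" for k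
  proof -
    obtain l B where l: "1 \<le> l" "0 < B"
      and B: "\<And>n F. 1 \<le> n \<Longrightarrow> finite F \<Longrightarrow> F \<subseteq> {1..} \<Longrightarrow>
        (\<Sum>j\<in>F. norm (toeplitz_column \<theta> n j) * ?b j k) \<le> B * exp (real l * \<beta> n)"
      by (rule power_series_column_bound[OF assms(1,2) \<theta> k], rule that)
    from dom l(1) obtain m C where m: "1 \<le> m" "0 < C"
      and C: "\<And>n. 1 \<le> n \<Longrightarrow> exp (real l * \<beta> n) \<le> C * a n m" by blast
    have "koethe_seminorm ?b k (toeplitz_column \<theta> n) \<le> B * C * a n m" if n: "1 \<le> n" for n
    proof -
      have "koethe_seminorm ?b k (toeplitz_column \<theta> n) \<le> B * exp (real l * \<beta> n)"
        by (rule koethe_seminorm_le[OF col_in[OF n] k B[OF n]])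
      also have "\<dots> \<le> B * (C * a n m)" using C[OF n] l(2) by (intro mult_left_mono) auto
      finally show ?thesis by (simp add: mult.assoc)
    qed
    then show ?thesis using m l by (intro exI[of _ m] exI[of _ "B * C"] conjI) auto
  qed
  from toeplitz_continuous_if_column_bound[OF assms(3) b col_in this]
  show "toeplitz_well_defined a ?b \<theta>"
    and "continuous_map (koethe_topology a) (koethe_topology ?b) (toeplitz_operator ?b \<theta>)"
    by blast+
qed

end
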